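(* Let $G=(V,E)$ be a DAG with $|V|=n$ whose maximum out-degree is at most $d_{out}$. Then there exists an $r^{(sin)}$-visit $\psi$ of $G$ such that $b_{r^{(sin)}}(\psi)\leq 4\left(\sqrt{2}+1\right)\sqrt{d_{out}\, n}$.
   Context: For a vertex $v$ of a finite DAG $G=(V,E)$, $\mathrm{pred}(v)=\{u : (u,v)\in E\}$ and $\mathrm{suc}(v)=\{u : (v,u)\in E\}$; the maximum out-degree is $\max_v|\mathrm{suc}(v)|$. A visit rule $r$ for $G$ assigns to each $v\in V$ a non-empty family $r(v)$ of subsets of $\mathrm{pred}(v)$, called enablers of $v$. An $r$-sequence is a sequence $\psi$ of distinct vertices such that for every $1\le i\le|\psi|$ the set of vertices of the prefix $\psi[1..i-1]$ contains some enabler $Q\in r(\psi[i])$. An $r$-visit is an $r$-sequence containing all $n$ vertices. The $r$-boundary of an $r$-sequence $\psi$ is $B_r(\psi)=\{v\in V\setminus\psi : \exists Q\neq\emptyset,\ Q\in r(v),\ Q\subseteq\psi\}$, and $b_r(\psi)=\max_{1\le i\le|\psi|}|B_r(\psi[1..i])|$. The singleton rule is $r^{(sin)}(v)=\{\{u\}: u\in\mathrm{pred}(v)\}$ if $\mathrm{pred}(v)\neq\emptyset$, and $r^{(sin)}(v)=\{\emptyset\}$ otherwise. *)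

theory Defs
  imports Complex_Main
begin

definition finite_dag :: "'a set \<Rightarrow> ('a \<times> 'a) set \<Rightarrow> bool" where
  "finite_dag V E \<longleftrightarrow> finite V \<and> E \<subseteq> V \<times> V \<and> acyclic E"

definition predecessors :: "('a \<times> 'a) set \<Rightarrow> 'a \<Rightarrow> 'a set" where
  "predecessors E v = {u. (u, v) \<in> E}"

definition successors :: "('a \<times> 'a) set \<Rightarrow> 'a \<Rightarrow> 'a set" where
  "successors E v = {u. (v, u) \<in> E}"

text \<open>The maximum over an empty index set is taken to be 0, both here and in \<open>max_boundary\<close>.\<close>

definition max_out_degree :: "'a set \<Rightarrow> ('a \<times> 'a) set \<Rightarrow> nat" where
  "max_out_degree V E = (if V = {} then 0 else (MAX v\<in>V. card (successors E v)))"

type_synonym 'a rule = "'a \<Rightarrow> 'a set set"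

definition visit_rule :: "'a set \<Rightarrow> ('a \<times> 'a) set \<Rightarrow> 'a rule \<Rightarrow> bool" where
  "visit_rule V E r \<longleftrightarrow> (\<forall>v\<in>V. r v \<noteq> {} \<and> (\<forall>Q\<in>r v. Q \<subseteq> predecessors E v))"

text \<open>List positions count from 0, so \<open>take i \<psi>\<close> consists of the vertices strictly before
  \<open>\<psi> ! i\<close>.\<close>

definition r_sequence :: "'a set \<Rightarrow> 'a rule \<Rightarrow> 'a list \<Rightarrow> bool" where
  "r_sequence V r \<psi> \<longleftrightarrow> set \<psi> \<subseteq> V \<and> distinct \<psi> \<and>
     (\<forall>i<length \<psi>. \<exists>Q\<in>r (\<psi> ! i). Q \<subseteq> set (take i \<psi>))"

definition r_visit :: "'a set \<Rightarrow> 'a rule \<Rightarrow> 'a list \<Rightarrow> bool" where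
  "r_visit V r \<psi> \<longleftrightarrow> r_sequence V r \<psi> \<and> set \<psi> = V"

definition boundary :: "'a set \<Rightarrow> 'a rule \<Rightarrow> 'a list \<Rightarrow> 'a set" where
  "boundary V r \<psi> = {v \<in> V - set \<psi>. \<exists>Q. Q \<noteq> {} \<and> Q \<in> r v \<and> Q \<subseteq> set \<psi>}"

definition max_boundary :: "'a set \<Rightarrow> 'a rule \<Rightarrow> 'a list \<Rightarrow> nat" where
  "max_boundary V r \<psi> =
     (if \<psi> = [] then 0 else (MAX i\<in>{1..length \<psi>}. card (boundary V r (take i \<psi>))))"

definition singleton_rule :: "('a \<times> 'a) set \<Rightarrow> 'a rule" where
  "singleton_rule E v =
     (if predecessors E v \<noteq> {} then {{u} | u. u \<in> predecessors E v} else {{}})"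

lemma visit_rule_singleton_rule: "visit_rule V E (singleton_rule E)"
  by (auto simp: visit_rule_def singleton_rule_def)

end

theory Submission
  imports Defs
begin

text \<open>
  Let \<open>F n = 4 (\<surd>2 + 1) \<surd>(d n)\<close> and \<open>w = \<surd>(d n / 2)\<close>, so that \<open>F n = F (n / 2) + 4 w\<close>.
  Split the \<open>n\<close> vertices into breadth-first layers from the start vertices and call a layer narrow
  if it has at most \<open>w\<close> vertices. The zones between consecutive narrow layers are visited one after
  another: outside the current zone, only the two delimiting layers, hence at most \<open>2 w\<close> vertices,
  can be in the boundary. A zone has fewer than \<open>n / w\<close> wide layers, so each of its vertices is
  reached along a path whose boundary is about \<open>d n / w = 2 w\<close> or less. By acyclicity there is a
  minimal vertex \<open>x\<close> with more than \<open>n / 2\<close> descendants in the zone (if there is none, every start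
  vertex is exhausted recursively). Walk to \<open>x\<close> and exhaust its successors recursively, each having
  at most \<open>n / 2\<close> descendants; this leaves no boundary other than that of the path. Fewer than
  \<open>n / 2\<close> vertices of the zone now remain, and they are again visited recursively.
\<close>

section \<open>Visits as growing vertex sets\<close>

text \<open>Under the singleton rule, the enabled vertices and the boundary depend only on the set
  visited so far, so a visit is kept as a chain of sets. \<open>P\<close> is the bound required at
  every stage; a general \<open>S\<close> lets partial visits be chained.\<close>

inductive visits :: "('a \<times> 'a) set \<Rightarrow> ('a set \<Rightarrow> bool) \<Rightarrow> 'a set \<Rightarrow> 'a set \<Rightarrow> 'a set \<Rightarrow> bool"
  for E P A S where
  refl: "P S \<Longrightarrow> visits E P A S S"
| step: "visits E P A S T \<Longrightarrow> v \<notin> T \<Longrightarrow> v \<in> A \<union> E `` T \<Longrightarrow> P (insert v T)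
    \<Longrightarrow> visits E P A S (insert v T)"

text \<open>Start vertices \<open>A\<close> do not count: in a recursive call they are already in the boundary of what
  has been visited before, and are accounted for there.\<close>

definition front :: "('a \<times> 'a) set \<Rightarrow> 'a set \<Rightarrow> 'a set \<Rightarrow> 'a set \<Rightarrow> 'a set" where
  "front E U A X = (U \<inter> E `` X) - X - A"

text \<open>Every vertex of \<open>U\<close> is reachable from \<open>A\<close> inside \<open>U\<close>, phrased as: no visit gets stuck.\<close>

definition accessible :: "('a \<times> 'a) set \<Rightarrow> 'a set \<Rightarrow> 'a set \<Rightarrow> bool" where
  "accessible E U A \<longleftrightarrow> (\<forall>X. X \<subset> U \<longrightarrow> (U - X) \<inter> (A \<union> E `` X) \<noteq> {})"

definition descendants :: "('a \<times> 'a) set \<Rightarrow> 'a set \<Rightarrow> 'a \<Rightarrow> 'a set" where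
  "descendants E U x = (E \<inter> U \<times> U)\<^sup>* `` {x}"

text \<open>\<open>ball E U A i\<close> collects the vertices at distance less than \<open>i\<close> from \<open>A\<close>, so that
  \<open>layer E U A i\<close> is the set of vertices at distance exactly \<open>i\<close>.\<close>

fun ball :: "('a \<times> 'a) set \<Rightarrow> 'a set \<Rightarrow> 'a set \<Rightarrow> nat \<Rightarrow> 'a set" where
  "ball E U A 0 = {}"
| "ball E U A (Suc i) = ball E U A i \<union> (U \<inter> (A \<union> E `` ball E U A i))"

definition layer :: "('a \<times> 'a) set \<Rightarrow> 'a set \<Rightarrow> 'a set \<Rightarrow> nat \<Rightarrow> 'a set" where
  "layer E U A i = ball E U A (Suc i) - ball E U A i"

section \<open>Composing visits\<close>

lemma visits_end: "visits E P A S T \<Longrightarrow> P T"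
  by (induction rule: visits.induct) auto

lemma visits_trans:
  assumes "visits E P A S T" "visits E P A T R"
  shows "visits E P A S R"
  using assms(2,1) by (induction rule: visits.induct) (auto intro: visits.step)

text \<open>Runs a visit of a region \<open>W\<close>, planned in isolation with its own starts,
  after \<open>S\<close>: by then these starts are enabled, and the last premise turns the local
  bound into the global one.\<close>

lemma visits_embed:
  assumes "visits E P' A' {} X" "X \<subseteq> W" "S \<inter> W = {}" "W \<inter> A' \<subseteq> A \<union> E `` S"
    and "\<And>X. X \<subseteq> W \<Longrightarrow> P' X \<Longrightarrow> P (S \<union> X)"
  shows "visits E P A S (S \<union> X)"
  using assms(1,2)
proof (induction rule: visits.induct)
  case refl
  then show ?case using assms(5)[of "{}"] by (auto intro: visits.refl)
next
  case (step T v)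
  have "visits E P A S (insert v (S \<union> T))"
  proof (rule visits.step)
    show "visits E P A S (S \<union> T)" using step by auto
    show "v \<notin> S \<union> T" using step.hyps step.prems assms(3) by auto
    show "v \<in> A \<union> E `` (S \<union> T)" using step.hyps step.prems assms(4) by blast
    show "P (insert v (S \<union> T))" using assms(5)[OF step.prems step.hyps(4)] by simp
  qed
  then show ?case by simp
qed

lemma visits_mono:
  assumes "visits E P' A S T" "\<And>X. X \<subseteq> T \<Longrightarrow> P' X \<Longrightarrow> P X"
  shows "visits E P A S T"
  using assms
proof (induction rule: visits.induct)
  case refl
  then show ?case by (auto intro: visits.refl)
next
  case (step T v)
  have "visits E P A S T" by (rule step.IH) (use step.prems in auto)
  then show ?case using step by (auto intro: visits.step)
qed

lemma visits_imp_list: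
  assumes "visits E P A {} T"
  shows "\<exists>\<psi>. distinct \<psi> \<and> set \<psi> = T \<and>
    (\<forall>i<length \<psi>. \<psi> ! i \<in> A \<union> E `` set (take i \<psi>)) \<and> (\<forall>i\<le>length \<psi>. P (set (take i \<psi>)))"
  using assms
proof (induction rule: visits.induct)
  case refl
  then show ?case by (intro exI[of _ "[]"]) auto
next
  case (step T v)
  then obtain \<psi> where \<psi>: "distinct \<psi>" "set \<psi> = T"
    "\<forall>i<length \<psi>. \<psi> ! i \<in> A \<union> E `` set (take i \<psi>)" "\<forall>i\<le>length \<psi>. P (set (take i \<psi>))"
    by blast
  have "\<forall>i<length (\<psi> @ [v]). (\<psi> @ [v]) ! i \<in> A \<union> E `` set (take i (\<psi> @ [v]))"
    using \<psi>(2,3) step.hyps by (auto simp: nth_append less_Suc_eq)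
  moreover have "\<forall>i\<le>length (\<psi> @ [v]). P (set (take i (\<psi> @ [v])))"
    using \<psi>(2,4) step.hyps by (auto simp: le_Suc_eq)
  ultimately show ?case using \<psi>(1,2) step.hyps(2)
    by (intro exI[of _ "\<psi> @ [v]"]) auto
qed

section \<open>Accessible sets and descendants\<close>

lemma accessibleD: "accessible E U A \<Longrightarrow> X \<subset> U \<Longrightarrow> (U - X) \<inter> (A \<union> E `` X) \<noteq> {}"
  by (simp add: accessible_def)

lemma accessible_mono:
  assumes "accessible E U A" "A \<subseteq> A'"
  shows "accessible E U A'"
  unfolding accessible_def
proof (intro allI impI)
  fix X assume "X \<subset> U"
  then have "(U - X) \<inter> (A \<union> E `` X) \<noteq> {}" using assms(1) by (rule accessibleD[rotated])
  then show "(U - X) \<inter> (A' \<union> E `` X) \<noteq> {}" using assms(2) by blast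
qed

text \<open>A set \<open>X\<close> at which the remainder gets stuck would make
  \<open>S \<union> X\<close> stuck in \<open>U\<close>.\<close>

lemma accessible_diff:
  assumes "accessible E U A" "S \<subseteq> U"
  shows "accessible E (U - S) ((U - S) \<inter> (A \<union> E `` S))"
  unfolding accessible_def
proof (intro allI impI)
  fix X assume "X \<subset> U - S"
  then have "S \<union> X \<subset> U" using assms(2) by blast
  then have "(U - (S \<union> X)) \<inter> (A \<union> E `` (S \<union> X)) \<noteq> {}"
    using assms(1) by (rule accessibleD[rotated])
  then show "(U - S - X) \<inter> ((U - S) \<inter> (A \<union> E `` S) \<union> E `` X) \<noteq> {}" by blast
qed

lemma visits_exists:
  assumes "finite U" "accessible E U A" "\<And>X. X \<subseteq> U \<Longrightarrow> P X"
  shows "visits E P A {} U"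
proof -
  have "visits E P A S U" if "S \<subseteq> U" for S
    using that
  proof (induction "card (U - S)" arbitrary: S rule: less_induct)
    case less
    show ?case
    proof (cases "S = U")
      case True
      then show ?thesis using assms(3) by (auto intro: visits.refl)
    next
      case False
      then obtain v where v: "v \<in> U - S" "v \<in> A \<union> E `` S"
        using accessibleD[OF assms(2), of S] less.prems by blast
      have "card (U - insert v S) < card (U - S)"
        using v assms(1) by (intro psubset_card_mono) auto
      then have "visits E P A (insert v S) U" using less v by auto
      moreover have "visits E P A S (insert v S)"
        using v less.prems assms(3) by (auto intro!: visits.intros)
      ultimately show ?thesis using visits_trans by blast
    qed
  qed
  then show ?thesis by simp
qed

lemma descendants_self: "x \<in> descendants E U x"
  by (simp add: descendants_def)

lemma descendants_subset: "x \<in> U \<Longrightarrow> descendants E U x \<subseteq> U"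
  by (auto simp: descendants_def elim: rtranclE)

lemma descendants_closed: "x \<in> U \<Longrightarrow> U \<inter> E `` descendants E U x \<subseteq> descendants E U x"
  using descendants_subset[of x U E]
  by (auto simp: descendants_def intro: rtrancl_into_rtrancl)

lemma descendants_unfold:
  "descendants E U x \<subseteq> insert x (\<Union>y \<in> U \<inter> E `` {x}. descendants E U y)"
  by (auto simp: descendants_def elim: converse_rtranclE)

lemma accessible_descendants: "accessible E (descendants E U x) {x}"
  unfolding accessible_def
proof (intro allI impI)
  fix X assume X: "X \<subset> descendants E U x"
  show "(descendants E U x - X) \<inter> ({x} \<union> E `` X) \<noteq> {}"
  proof (rule ccontr)
    assume none: "\<not> ?thesis"
    have "y \<in> X" if "(x, y) \<in> (E \<inter> U \<times> U)\<^sup>*" for y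
      using that
    proof (induction rule: rtrancl_induct)
      case base
      then show ?case using none descendants_self[of x E U] by blast
    next
      case (step y z)
      then have "z \<in> descendants E U x"
        by (auto simp: descendants_def intro: rtrancl_into_rtrancl)
      then show ?case using none step by blast
    qed
    then show False using X by (auto simp: descendants_def)
  qed
qed

section \<open>Breadth-first layers\<close>

lemma ball_mono: "i \<le> j \<Longrightarrow> ball E U A i \<subseteq> ball E U A j"
  by (rule lift_Suc_mono_le) auto

lemma ball_subset: "ball E U A i \<subseteq> U"
  by (induction i) auto

lemma card_ball_Suc:
  "finite U \<Longrightarrow> card (ball E U A (Suc i)) = card (ball E U A i) + card (layer E U A i)"
  unfolding layer_def
  by (metis Diff_disjoint Diff_partition ball_mono ball_subset card_Un_disjoint finite_Diff
      finite_subset le_SucI order_refl)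

lemma accessible_ball: "accessible E (ball E U A b) A"
  unfolding accessible_def
proof (intro allI impI)
  fix X assume X: "X \<subset> ball E U A b"
  then have ex: "\<exists>i. \<not> ball E U A i \<subseteq> X" by blast
  \<comment> \<open>At the least such \<open>i\<close> the previous ball lies inside
    \<open>X\<close>, so a vertex of \<open>ball E U A i\<close> outside \<open>X\<close> is a start
    or a successor of \<open>X\<close>.\<close>
  define i where "i = (LEAST i. \<not> ball E U A i \<subseteq> X)"
  have i: "\<not> ball E U A i \<subseteq> X" using LeastI_ex[OF ex] by (simp add: i_def)
  then obtain j where j: "i = Suc j" by (cases i) auto
  have "ball E U A j \<subseteq> X" using not_less_Least[of j "\<lambda>i. \<not> ball E U A i \<subseteq> X"] j
    by (auto simp: i_def)
  moreover have "ball E U A i \<subseteq> ball E U A b"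
    using Least_le[of "\<lambda>i. \<not> ball E U A i \<subseteq> X" b] X by (intro ball_mono) (auto simp: i_def)
  ultimately show "(ball E U A b - X) \<inter> (A \<union> E `` X) \<noteq> {}"
    using i unfolding j ball.simps by blast
qed

lemma layer_eq: "layer E U A a = U \<inter> (A \<union> E `` ball E U A a) - ball E U A a"
  by (auto simp: layer_def)

lemma accessible_zone:
  assumes "a < b"
  shows "accessible E (ball E U A b - ball E U A a) (layer E U A a)"
proof -
  have "ball E U A (Suc a) \<subseteq> ball E U A b" "ball E U A b \<subseteq> U" "ball E U A a \<subseteq> ball E U A b"
    using assms by (auto intro!: ball_mono ball_subset simp del: ball.simps)
  moreover from this
  have "(ball E U A b - ball E U A a) \<inter> (A \<union> E `` ball E U A a) = layer E U A a"
    by (auto simp: layer_def)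
  ultimately show ?thesis using accessible_diff[OF accessible_ball] by metis
qed

text \<open>Going back layer by layer gives a path with at most one vertex in each of the layers
  \<open>a\<close> to \<open>a + j\<close>. Bounding the visited set is enough: the out-degree then
  bounds its front.\<close>

lemma zone_path:
  assumes "z \<in> ball E U A (Suc (a + j)) - ball E U A a"
  shows "\<exists>S \<subseteq> ball E U A (Suc (a + j)) - ball E U A a.
    z \<in> S \<and> visits E (\<lambda>X. finite X \<and> card X \<le> Suc j) (layer E U A a) {} S"
  using assms
proof (induction j arbitrary: z)
  case 0
  then have "visits E (\<lambda>X. finite X \<and> card X \<le> Suc 0) (layer E U A a) {} {z}"
    by (intro visits.step visits.refl) (auto simp: layer_def)
  then show ?case using 0 by (intro exI[of _ "{z}"]) auto
next
  case (Suc j)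
  let ?B = "ball E U A"
  have mono: "?B (Suc (a + j)) \<subseteq> ?B (Suc (a + Suc j))" by (rule ball_mono) simp
  show ?case
  proof (cases "z \<in> ?B (Suc (a + j))")
    case True
    then obtain S where "S \<subseteq> ?B (Suc (a + j)) - ?B a" "z \<in> S"
      "visits E (\<lambda>X. finite X \<and> card X \<le> Suc j) (layer E U A a) {} S"
      using Suc by blast
    moreover from this(3)
    have "visits E (\<lambda>X. finite X \<and> card X \<le> Suc (Suc j)) (layer E U A a) {} S"
      by (rule visits_mono) auto
    ultimately show ?thesis using mono by blast
  next
    case False
    \<comment> \<open>Outside \<open>?B (Suc 0)\<close>, \<open>z\<close> is no start, so it has a
      predecessor \<open>u\<close> in the smaller ball; outside \<open>?B (Suc a)\<close>, it has
      none in \<open>?B a\<close>, so the path stays in the zone.\<close>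
    have "?B (Suc a) \<subseteq> ?B (Suc (a + j))" "?B (Suc 0) \<subseteq> ?B (Suc (a + j))"
      by (rule ball_mono; simp)+
    then have z: "z \<notin> ?B (Suc a)" "z \<notin> ?B (Suc 0)" using False by blast+
    have "z \<in> U" using Suc.prems ball_subset[of E U A "Suc (a + Suc j)"] by blast
    with z False Suc.prems obtain u where u: "u \<in> ?B (Suc (a + j))" "(u, z) \<in> E" "u \<notin> ?B a"
      by (auto simp del: ball.simps(2) simp: ball.simps(2)[of E U A a]
         ball.simps(2)[of E U A "Suc (a + j)"] ball.simps(2)[of E U A 0])
    then obtain S where S: "S \<subseteq> ?B (Suc (a + j)) - ?B a" "u \<in> S"
      "visits E (\<lambda>X. finite X \<and> card X \<le> Suc j) (layer E U A a) {} S"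
      using Suc.IH[of u] by blast
    have "visits E (\<lambda>X. finite X \<and> card X \<le> Suc (Suc j)) (layer E U A a) {} (insert z S)"
    proof (rule visits.step)
      show "visits E (\<lambda>X. finite X \<and> card X \<le> Suc (Suc j)) (layer E U A a) {} S"
        using S(3) by (rule visits_mono) auto
      show "z \<notin> S" using S(1) False by blast
      show "z \<in> layer E U A a \<union> E `` S" using u S by blast
      show "finite (insert z S) \<and> card (insert z S) \<le> Suc (Suc j)"
        using visits_end[OF S(3)] by (auto simp: card_insert_if)
    qed
    then show ?thesis using S mono Suc.prems by (intro exI[of _ "insert z S"]) blast
  qed
qed

lemma card_ball_ge:
  assumes "finite U" "\<And>i. a < i \<Longrightarrow> i < Suc (a + k) \<Longrightarrow> w \<le> real (card (layer E U A i))"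
  shows "real (card (layer E U A a)) + real k * w \<le> real (card (ball E U A (Suc (a + k))))"
  using assms(2)
proof (induction k)
  case 0
  then show ?case using card_ball_Suc[OF assms(1), of E A a] by simp
next
  case (Suc k)
  have "real (card (layer E U A a)) + real k * w \<le> real (card (ball E U A (Suc (a + k))))"
    using Suc by simp
  moreover have "w \<le> real (card (layer E U A (Suc (a + k))))" using Suc.prems by simp
  ultimately show ?case using card_ball_Suc[OF assms(1), of E A "Suc (a + k)"]
    by (simp add: algebra_simps del: ball.simps)
qed

section \<open>Visiting one zone\<close>

locale bounded_degree_dag =
  fixes E :: "('a \<times> 'a) set" and d :: nat
  assumes finite_E: "finite E" and acyclic_E: "acyclic E"
    and degree: "card (E `` {u}) \<le> d"
begin

lemma finite_image: "finite (E `` X)"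
  using finite_E by (rule finite_Image)

lemma card_image_le: "finite X \<Longrightarrow> card (E `` X) \<le> d * card X"
proof (induction rule: finite_induct)
  case (insert x F)
  have "E `` insert x F = E `` {x} \<union> E `` F" by blast
  then have "card (E `` insert x F) \<le> card (E `` {x}) + card (E `` F)"
    by (metis card_Un_le)
  then show ?case using insert degree[of x] by simp
qed simp

end

text \<open>\<open>small\<close> is the induction hypothesis of the final recursion, with bound
  \<open>K\<close>. \<open>n\<close> will be the size of the whole region of which \<open>Z\<close>
  is a zone, so halves are measured against that region.\<close>

locale zone = bounded_degree_dag +
  fixes Z A :: "'a set" and n :: nat and K :: real
  assumes finite_Z: "finite Z" and starts: "A \<subseteq> Z" and acc: "accessible E Z A"
    and card_Z: "card Z \<le> n" and K_nonneg: "0 \<le> K"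
    and small: "\<And>W A'. W \<subseteq> Z \<Longrightarrow> A' \<subseteq> W \<Longrightarrow> accessible E W A' \<Longrightarrow> 2 * card W \<le> n \<Longrightarrow>
      visits E (\<lambda>X. real (card (front E W A' X)) \<le> K) A' {} W"
begin

text \<open>\<open>S\<close> is the path, \<open>C\<close> what has been exhausted, \<open>W\<close>
  the region to exhaust next. Neither \<open>C\<close> nor \<open>W\<close> leads to anything new
  outside \<open>W\<close>, so only successors of \<open>S\<close> add to the front of the recursive
  call.\<close>

lemma visits_absorb:
  assumes sub: "S \<subseteq> Z" "W \<subseteq> Z" "2 * card W \<le> n"
    and C: "Z \<inter> E `` C \<subseteq> S \<union> C" and disj: "(S \<union> C) \<inter> W = {}"
    and W: "Z \<inter> E `` W \<subseteq> S \<union> C \<union> W"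
    and accW: "accessible E W (W \<inter> (A \<union> E `` (S \<union> C)))"
  shows "visits E (\<lambda>X. real (card (front E Z A X)) \<le> real (d * card S) + K) A
    (S \<union> C) (S \<union> C \<union> W)"
proof (rule visits_embed[where W = W])
  let ?A = "W \<inter> (A \<union> E `` (S \<union> C))"
  show "visits E (\<lambda>X. real (card (front E W ?A X)) \<le> K) ?A {} W"
    using small[OF sub(2) _ accW sub(3)] by blast
  fix X assume X: "X \<subseteq> W" "real (card (front E W ?A X)) \<le> K"
  \<comment> \<open>Starts of the recursive call are missing from its front, but each lies in
    \<open>A\<close>, which is ignored, or is a successor of \<open>S\<close>, as \<open>C\<close>
    has no successors in \<open>W\<close>.\<close>
  have "front E Z A (S \<union> C \<union> X) \<subseteq> E `` S \<union> front E W ?A X"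
    using X C W unfolding front_def by blast
  moreover have "finite (front E W ?A X)" using finite_image by (simp add: front_def)
  ultimately have "card (front E Z A (S \<union> C \<union> X)) \<le> card (E `` S) + card (front E W ?A X)"
    using finite_image by (meson card_Un_le card_mono finite_UnI le_trans)
  then show "real (card (front E Z A (S \<union> C \<union> X))) \<le> real (d * card S) + K"
    using X(2) card_image_le[OF finite_subset[OF sub(1) finite_Z]] by linarith
qed (use disj in auto)

text \<open>The descendant sets are exhausted one after another. Each is closed under successors in
  \<open>Z\<close>, so once finished it adds nothing to the front, and \<open>K\<close> does not
  accumulate.\<close>

lemma visits_light:
  assumes "S \<subseteq> Z" "Y \<subseteq> Z \<inter> (A \<union> E `` S)"
    and "\<And>y. y \<in> Y \<Longrightarrow> 2 * card (descendants E Z y) \<le> n"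
  shows "visits E (\<lambda>X. real (card (front E Z A X)) \<le> real (d * card S) + K) A
    S (S \<union> (\<Union>y\<in>Y. descendants E Z y))"
proof -
  have "finite Y" using assms(2) finite_Z finite_subset by blast
  then show ?thesis using assms(2,3)
  proof (induction rule: finite_induct)
    case empty
    have "card (front E Z A S) \<le> card (E `` S)"
      using finite_image by (intro card_mono) (auto simp: front_def)
    then have "real (card (front E Z A S)) \<le> real (d * card S) + K"
      using card_image_le[OF finite_subset[OF assms(1) finite_Z]] K_nonneg by linarith
    then show ?case by (simp add: visits.refl)
  next
    case (insert y Y)
    let ?C = "\<Union>y\<in>Y. descendants E Z y"
    let ?D = "descendants E Z y"
    let ?W = "?D - (S \<union> ?C)"
    have y: "y \<in> Z" "y \<in> A \<union> E `` S" using insert.prems by auto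
    have D: "?D \<subseteq> Z" "Z \<inter> E `` ?D \<subseteq> ?D"
      using descendants_subset[OF y(1)] descendants_closed[OF y(1)] by auto
    have absorb: "visits E (\<lambda>X. real (card (front E Z A X)) \<le> real (d * card S) + K) A
      (S \<union> ?C) (S \<union> ?C \<union> ?W)"
    proof (rule visits_absorb[OF assms(1)])
      show "?W \<subseteq> Z" using D by blast
      have "card ?W \<le> card ?D" using D finite_Z by (intro card_mono) (auto intro: finite_subset)
      then show "2 * card ?W \<le> n" using insert.prems(2)[of y] by simp
      show "Z \<inter> E `` ?C \<subseteq> S \<union> ?C"
        using insert.prems(1) descendants_closed[of _ Z E] by fastforce
      show "(S \<union> ?C) \<inter> ?W = {}" by blast
      show "Z \<inter> E `` ?W \<subseteq> S \<union> ?C \<union> ?W" using D by blast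
      have "accessible E (?D - ?D \<inter> (S \<union> ?C))
          ((?D - ?D \<inter> (S \<union> ?C)) \<inter> ({y} \<union> E `` (?D \<inter> (S \<union> ?C))))"
        by (rule accessible_diff[OF accessible_descendants]) blast
      moreover have "?D - ?D \<inter> (S \<union> ?C) = ?W" by blast
      moreover have "?W \<inter> ({y} \<union> E `` (?D \<inter> (S \<union> ?C))) \<subseteq> ?W \<inter> (A \<union> E `` (S \<union> ?C))"
        using y by blast
      ultimately show "accessible E ?W (?W \<inter> (A \<union> E `` (S \<union> ?C)))"
        by (simp only: accessible_mono)
    qed
    have "visits E (\<lambda>X. real (card (front E Z A X)) \<le> real (d * card S) + K) A S (S \<union> ?C)"
      using insert.IH insert.prems by blast
    from visits_trans[OF this absorb] show ?case
      by (rule back_subst[where P = "visits E _ A S"]) blast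
  qed
qed

text \<open>Only one path of at most \<open>k + 1\<close> vertices is charged, with \<open>d\<close>
  per vertex; all else is exhausted by recursive calls made one at a time, so \<open>K\<close>
  enters once.\<close>

lemma visits_zone:
  assumes "\<And>z. z \<in> Z \<Longrightarrow>
    \<exists>S\<subseteq>Z. z \<in> S \<and> visits E (\<lambda>X. finite X \<and> card X \<le> Suc k) A {} S"
  shows "visits E (\<lambda>X. real (card (front E Z A X)) \<le> real (d * Suc k) + K) A {} Z"
proof (cases "\<exists>x\<in>Z. n < 2 * card (descendants E Z x)")
  case False
  let ?C = "\<Union>y\<in>A. descendants E Z y"
  have "visits E (\<lambda>X. real (card (front E Z A X)) \<le> real (d * card ({} :: 'a set)) + K) A
      {} ({} \<union> ?C)"
    by (rule visits_light) (use False starts in \<open>auto simp: not_less\<close>)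
  \<comment> \<open>\<open>?C\<close> contains the starts and is closed under successors in
    \<open>Z\<close>, so accessibility leaves nothing outside it.\<close>
  moreover have "?C = Z"
  proof (rule ccontr)
    assume "?C \<noteq> Z"
    then have "?C \<subset> Z" using starts descendants_subset[of _ Z E] by blast
    then have "(Z - ?C) \<inter> (A \<union> E `` ?C) \<noteq> {}" by (rule accessibleD[OF acc])
    then obtain v where "v \<in> (Z - ?C) \<inter> (A \<union> E `` ?C)" by (meson ex_in_conv)
    then have v: "v \<in> Z" "v \<notin> ?C" "v \<in> A \<union> E `` ?C" by simp_all
    have "v \<notin> A" using v(2) descendants_self[of v E Z] by blast
    then obtain y u where "y \<in> A" "u \<in> descendants E Z y" "(u, v) \<in> E" using v(3) by blast
    then show False using v starts descendants_closed[of y Z E] by blast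
  qed
  ultimately show ?thesis by (auto elim!: visits_mono simp: add_increasing)
next
  case True
  \<comment> \<open>Minimality along the converse: \<open>x\<close> has more than
    \<open>n / 2\<close> descendants, but none of its successors in \<open>Z\<close> has.\<close>
  have "wf (E\<inverse>)" using finite_E acyclic_E by (rule finite_acyclic_wf_converse)
  moreover obtain x0 where "x0 \<in> {x\<in>Z. n < 2 * card (descendants E Z x)}" using True by blast
  ultimately obtain x where "x \<in> {x\<in>Z. n < 2 * card (descendants E Z x)}"
    "\<And>y. (y, x) \<in> E\<inverse> \<Longrightarrow> y \<notin> {x\<in>Z. n < 2 * card (descendants E Z x)}"
    by (rule wfE_min) blast
  then have x: "x \<in> Z" "n < 2 * card (descendants E Z x)"
    and min: "\<And>y. (x, y) \<in> E \<Longrightarrow> y \<in> Z \<Longrightarrow> 2 * card (descendants E Z y) \<le> n"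
    by (auto simp: not_less)
  obtain S where S: "S \<subseteq> Z" "x \<in> S" "visits E (\<lambda>X. finite X \<and> card X \<le> Suc k) A {} S"
    using assms[OF x(1)] by blast
  let ?P = "\<lambda>X. real (card (front E Z A X)) \<le> real (d * Suc k) + K"
  let ?Y = "Z \<inter> E `` {x}"
  let ?C = "\<Union>y\<in>?Y. descendants E Z y"
  let ?W = "Z - (S \<union> ?C)"
  have "d * card S \<le> d * Suc k" using visits_end[OF S(3)] by (intro mult_le_mono2) simp
  then have P_mono: "?P X" if "real (card (front E Z A X)) \<le> real (d * card S) + K" for X
    using that by (smt (verit) of_nat_mono)
  have path: "visits E ?P A {} S"
    using S(3)
  proof (rule visits_mono)
    fix X :: "'a set" assume X: "finite X \<and> card X \<le> Suc k"
    have "card (front E Z A X) \<le> card (E `` X)"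
      using finite_image by (intro card_mono) (auto simp: front_def)
    also have "\<dots> \<le> d * card X" using X card_image_le by blast
    also have "\<dots> \<le> d * Suc k" using X by (intro mult_le_mono2) simp
    finally show "?P X" using K_nonneg by linarith
  qed
  have light: "visits E ?P A S (S \<union> ?C)"
    by (rule visits_mono[OF visits_light[OF S(1), of ?Y]]) (use S min P_mono in auto)
  have rest: "visits E ?P A (S \<union> ?C) (S \<union> ?C \<union> ?W)"
  proof (rule visits_mono[OF visits_absorb[OF S(1), of ?W ?C]])
    have "?C \<subseteq> Z" using descendants_subset[of _ Z E] by blast
    \<comment> \<open>\<open>x\<close> is on the path and its other descendants are in
      \<open>?C\<close>, so the remainder misses more than \<open>n / 2\<close> vertices.\<close>
    have "?W \<subseteq> Z - descendants E Z x" using descendants_unfold[of E Z x] S(2) by blast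
    then have "card ?W \<le> card (Z - descendants E Z x)"
      using finite_Z by (intro card_mono) auto
    also have "\<dots> = card Z - card (descendants E Z x)"
      using descendants_subset[OF x(1)] finite_Z by (meson card_Diff_subset finite_subset)
    finally show "2 * card ?W \<le> n" using card_Z x(2) by linarith
    show "Z \<inter> E `` ?C \<subseteq> S \<union> ?C" using descendants_closed[of _ Z E] by blast
    show "accessible E ?W (?W \<inter> (A \<union> E `` (S \<union> ?C)))"
      by (rule accessible_diff[OF acc]) (use S(1) \<open>?C \<subseteq> Z\<close> in blast)
  qed (use P_mono in auto)
  have "S \<union> ?C \<union> ?W = Z" using S(1) descendants_subset[of _ Z E] by blast
  with visits_trans[OF visits_trans[OF path light] rest] show ?thesis by simp
qed

end

section \<open>From zone to zone, and the recursion\<close>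

context bounded_degree_dag
begin

text \<open>At \<open>a = 0\<close> the layer may be wide: it consists of starts, which
  \<open>front\<close> ignores.\<close>

lemma visits_between_narrow:
  fixes w K :: real
  assumes U: "finite U" and d: "0 < d" "2 * d \<le> card U" and w: "w = sqrt (real d * card U / 2)"
    and a: "a = 0 \<or> real (card (layer E U A a)) \<le> w"
    and b: "a < b" "real (card (layer E U A b)) \<le> w"
    and wide: "\<And>i. a < i \<Longrightarrow> i < b \<Longrightarrow> w < real (card (layer E U A i))"
    and K: "0 \<le> K"
    and small: "\<And>W A'. W \<subseteq> U \<Longrightarrow> A' \<subseteq> W \<Longrightarrow> accessible E W A' \<Longrightarrow> 2 * card W \<le> card U \<Longrightarrow>
      visits E (\<lambda>X. real (card (front E W A' X)) \<le> K) A' {} W"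
  shows "visits E (\<lambda>X. real (card (front E U A X)) \<le> 4 * w + K) A
    (ball E U A a) (ball E U A b)"
proof -
  let ?B = "ball E U A" and ?L = "layer E U A"
  let ?Z = "?B b - ?B a"
  \<comment> \<open>\<open>k\<close> layers lie strictly between; the zone consists of the layers
    \<open>a\<close> to \<open>a + k\<close>, so paths in it take up to \<open>k + 1\<close>
    vertices.\<close>
  obtain k where k: "b = Suc (a + k)" using b(1) less_iff_Suc_add by auto
  have ZU: "?Z \<subseteq> U" using ball_subset[of E U A b] by blast
  have mono: "?B a \<subseteq> ?B b" "?B (Suc a) \<subseteq> ?B b"
    using b(1) by (auto intro!: ball_mono simp del: ball.simps)
  interpret zone E d ?Z "?L a" "card U" K
  proof
    show "finite ?Z" using ZU U finite_subset by blast
    show "?L a \<subseteq> ?Z" using mono by (auto simp: layer_def)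
    show "accessible E ?Z (?L a)" by (rule accessible_zone[OF b(1)])
    show "card ?Z \<le> card U" by (rule card_mono[OF U ZU])
  qed (use K small ZU in blast)+
  have zone: "visits E (\<lambda>X. real (card (front E ?Z (?L a) X)) \<le> real (d * Suc k) + K) (?L a) {} ?Z"
    by (rule visits_zone) (use zone_path[of _ E U A a k] k in auto)
  \<comment> \<open>What layer \<open>a\<close> can contribute to the front.\<close>
  define \<alpha> where "\<alpha> = (if a = 0 then {} else ?L a)"
  have fin: "finite \<alpha>" "finite (?L a)" "finite (?L b)"
    using U ball_subset[of E U A] by (auto simp: \<alpha>_def layer_def intro: finite_subset)
  have \<alpha>: "real (card \<alpha>) \<le> w" "card \<alpha> \<le> card (?L a)"
    using a by (auto simp: \<alpha>_def w)
  have "real (card (?L a)) + real k * w \<le> real (card (?B b))"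
    unfolding k by (rule card_ball_ge[OF U]) (use wide k in fastforce)
  moreover have "card (?B b) + card (?L b) \<le> card U"
    using card_ball_Suc[OF U, of E A b] card_mono[OF U ball_subset[of E U A "Suc b"]] by linarith
  ultimately have count: "real (card \<alpha>) + real (card (?L b)) + real k * w \<le> real (card U)"
    using \<alpha>(2) by linarith
  have w2: "w * w = real d * card U / 2" by (simp add: w)
  have wpos: "0 < w" using d by (simp add: w)
  have "real d * real d \<le> w * w"
    using d mult_left_mono[of "real (2 * d)" "real (card U)" "real d"] by (simp add: w2)
  then have dw: "real d \<le> w" using wpos power2_le_imp_le[of "real d" w]
    by (simp add: power2_eq_square)
  \<comment> \<open>The two narrow layers are disjoint from the wide ones; this pays for the extra \<open>d\<close> in
      \<open>d * Suc k\<close>.\<close>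
  have cost: "real (card \<alpha>) + real (card (?L b)) + real (d * Suc k) \<le> 4 * w"
  proof -
    define s where "s = real (card \<alpha>) + real (card (?L b))"
    have s: "s \<le> 2 * w" using \<alpha>(1) b(2) by (simp add: s_def)
    have "real d * (s + real k * w) \<le> real d * real (card U)"
      using count by (intro mult_left_mono) (auto simp: s_def)
    then have "d * s + d * k * w \<le> 2 * (w * w)" by (simp add: w2 algebra_simps)
    \<comment> \<open>\<open>w * s\<close> is split into \<open>d * s\<close>, paid for by the
      vertex count, and \<open>(w - d) * s\<close>, paid for by narrowness. The latter leaves
      \<open>2 * d * w\<close> to spare, which covers the extra \<open>d * w\<close>.\<close>
    moreover have "(w - d) * s \<le> (w - d) * (2 * w)" using s dw by (intro mult_left_mono) auto
    ultimately have "w * (s + d * k + d) \<le> w * (4 * w) - d * w"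
      by (simp add: algebra_simps)
    also have "\<dots> \<le> w * (4 * w)" using wpos by simp
    finally have "s + d * k + d \<le> 4 * w" using wpos by (simp only: mult_le_cancel_left_pos)
    then show ?thesis by (simp add: s_def algebra_simps)
  qed
  have "visits E (\<lambda>X. real (card (front E U A X)) \<le> 4 * w + K) A (?B a) (?B a \<union> ?Z)"
    using zone
  proof (rule visits_embed)
    show "?Z \<subseteq> ?Z" "?B a \<inter> ?Z = {}" by auto
    show "?Z \<inter> ?L a \<subseteq> A \<union> E `` ?B a" by (auto simp: layer_eq)
    fix X assume X: "X \<subseteq> ?Z" "real (card (front E ?Z (?L a) X)) \<le> real (d * Suc k) + K"
    \<comment> \<open>A successor of \<open>?B b\<close> outside it is in \<open>?L b\<close>. A
      front vertex inside \<open>?B b\<close> with a predecessor in \<open>?B a\<close> is in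
      \<open>?L a\<close>; all others are reached from \<open>X\<close>.\<close>
    have "front E U A (?B a \<union> X) \<subseteq> \<alpha> \<union> ?L b \<union> front E ?Z (?L a) X"
    proof
      fix v assume v: "v \<in> front E U A (?B a \<union> X)"
      then obtain u where u: "u \<in> ?B a \<union> X" "(u, v) \<in> E" by (auto simp: front_def)
      have "u \<in> ?B b" using u X(1) mono by blast
      then have vb: "v \<in> ?B (Suc b)" using u v by (auto simp: front_def)
      show "v \<in> \<alpha> \<union> ?L b \<union> front E ?Z (?L a) X"
      proof (cases "v \<in> ?B b \<and> v \<notin> \<alpha>")
        case True
        have "v \<notin> ?L a" using True v by (auto simp: \<alpha>_def layer_def front_def split: if_splits)
        moreover from this have "u \<in> X" using u v by (auto simp: layer_eq front_def)
        ultimately show ?thesis using True u v by (auto simp: front_def)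
      qed (use vb in \<open>auto simp: layer_def simp del: ball.simps\<close>)
    qed
    moreover have "finite (front E ?Z (?L a) X)" using finite_image by (simp add: front_def)
    ultimately have "card (front E U A (?B a \<union> X)) \<le>
        card \<alpha> + card (?L b) + card (front E ?Z (?L a) X)"
      using fin by (meson add_le_mono1 card_Un_le card_mono finite_UnI le_trans)
    then show "real (card (front E U A (?B a \<union> X))) \<le> 4 * w + K" using X(2) cost by linarith
  qed
  moreover have "?B a \<union> ?Z = ?B b" using mono by blast
  ultimately show ?thesis by simp
qed

lemma visits_sqrt_bound:
  assumes "finite U" "A \<subseteq> U" "accessible E U A"
  shows "visits E (\<lambda>X. real (card (front E U A X)) \<le> 4 * (sqrt 2 + 1) * sqrt (real d * card U))
    A {} U"
  using assms
proof (induction "card U" arbitrary: U A rule: less_induct)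
  case less
  let ?c = "4 * (sqrt 2 + 1) :: real"
  consider "d = 0" | "0 < d" "card U < 2 * d" | "0 < d" "2 * d \<le> card U" by linarith
  then show ?case
  proof cases
    case 1
    have "E `` {u} = {}" for u using degree[of u] 1 finite_image by simp
    then have "(u, v) \<notin> E" for u v by (metis Image_singleton_iff empty_iff)
    then have "front E U A X = {}" for X by (auto simp: front_def)
    then show ?thesis by (intro visits_exists less.prems) simp
  next
    \<comment> \<open>With so few vertices any order will do: the front never exceeds
      \<open>card U\<close>, which is below \<open>2 * d\<close>.\<close>
    case 2
    show ?thesis
    proof (rule visits_exists[OF less.prems(1,3)])
      fix X
      have "card (front E U A X) \<le> card U"
        using less.prems(1) by (intro card_mono) (auto simp: front_def)
      also have "real (card U) \<le> sqrt (4 * (real d * card U))"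
      proof (rule real_le_rsqrt)
        have "real (card U) * card U \<le> (4 * real d) * card U"
          using 2 by (intro mult_right_mono) auto
        then show "(real (card U))\<^sup>2 \<le> 4 * (real d * card U)" by (simp add: power2_eq_square)
      qed
      also have "\<dots> = 2 * sqrt (real d * card U)" by (simp add: real_sqrt_mult)
      also have "\<dots> \<le> ?c * sqrt (real d * card U)"
        by (intro mult_right_mono) (auto simp: algebra_simps intro: add_increasing)
      finally show "real (card (front E U A X)) \<le> ?c * sqrt (real d * card U)" by simp
    qed
  next
    case 3
    define w where "w = sqrt (real d * card U / 2)"
    \<comment> \<open>The constant is chosen so that \<open>(sqrt 2 - 1) * ?c = 4\<close>, which
      closes the recursion.\<close>
    have K: "4 * w + ?c * w = ?c * sqrt (real d * card U)"
    proof -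
      have "sqrt (real d * card U) = sqrt 2 * w"
        by (simp add: w_def flip: real_sqrt_mult)
      then show ?thesis by (simp add: algebra_simps)
    qed
    have w0: "0 \<le> w" by (simp add: w_def)
    have small: "visits E (\<lambda>X. real (card (front E W A' X)) \<le> ?c * w) A' {} W"
      if W: "W \<subseteq> U" "A' \<subseteq> W" "accessible E W A'" "2 * card W \<le> card U" for W A'
    proof (rule visits_mono[OF less.hyps])
      show "card W < card U" using W(4) 3 by linarith
      show "finite W" using W(1) less.prems(1) finite_subset by blast
      have "real d * card W \<le> real d * card U / 2"
        using W(4) mult_left_mono[of "real (2 * card W)" "real (card U)" "real d"] by simp
      then have "?c * sqrt (real d * card W) \<le> ?c * w"
        unfolding w_def by (intro mult_left_mono) auto
      then show "real (card (front E W A' X)) \<le> ?c * w"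
        if "real (card (front E W A' X)) \<le> ?c * sqrt (real d * card W)" for X
        using that by linarith
    qed (use W in auto)
    let ?P = "\<lambda>X. real (card (front E U A X)) \<le> 4 * w + ?c * w"
    let ?B = "ball E U A" and ?L = "layer E U A"
    \<comment> \<open>Inner induction from one narrow layer to the next, on the number of unvisited
      vertices; it is used at \<open>a = 0\<close>, where \<open>?B 0\<close> is empty.\<close>
    have "visits E ?P A (?B a) U" if "a = 0 \<or> real (card (?L a)) \<le> w" for a
      using that
    proof (induction "card (U - ?B a)" arbitrary: a rule: less_induct)
      case narrow: less
      show ?case
      proof (cases "?B a = U")
        case True
        moreover have "front E U A U = {}" by (auto simp: front_def)
        ultimately show ?thesis using w0 by (auto intro!: visits.refl)
      next
        case False
        have step: "?L i \<noteq> {}" if "?B i \<noteq> U" for i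
        proof -
          have "?B i \<subset> U" using that ball_subset[of E U A i] by blast
          then have "(U - ?B i) \<inter> (A \<union> E `` ?B i) \<noteq> {}"
            by (rule accessibleD[OF less.prems(3)])
          then show ?thesis by (auto simp: layer_def)
        qed
        \<comment> \<open>Empty layers count as narrow, and an endless run of wide ones would
          outgrow \<open>U\<close>.\<close>
        have ex: "\<exists>b>a. real (card (?L b)) \<le> w"
        proof (rule ccontr)
          assume "\<not> ?thesis"
          then have nonempty: "0 < card (?L i)" if "a < i" for i
            using that w0 by (smt (verit) of_nat_0 of_nat_0_less_iff)
          have "j \<le> card (?B (Suc a + j))" for j
          proof (induction j)
            case (Suc j)
            then show ?case
              using nonempty[of "Suc a + j"] card_ball_Suc[OF less.prems(1), of E A "Suc a + j"]
              by (simp del: ball.simps)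
          qed simp
          from this[of "Suc (card U)"] show False
            using card_mono[OF less.prems(1) ball_subset[of E U A "Suc a + Suc (card U)"]] by linarith
        qed
        define b where "b = (LEAST b. a < b \<and> real (card (?L b)) \<le> w)"
        have b: "a < b" "real (card (?L b)) \<le> w"
          using LeastI_ex[OF ex] by (auto simp: b_def)
        have wide: "w < real (card (?L i))" if "a < i" "i < b" for i
          using that not_less_Least[of i "\<lambda>b. a < b \<and> real (card (?L b)) \<le> w"]
          by (auto simp: b_def)
        have "visits E ?P A (?B a) (?B b)"
          by (rule visits_between_narrow[OF less.prems(1) 3 w_def narrow.prems b wide _ small])
            (use w0 in auto)
        moreover have "visits E ?P A (?B b) U"
        proof (rule narrow.hyps)
          have "?B (Suc a) \<subseteq> ?B b" using b(1) by (intro ball_mono) simp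
          moreover have "?L a \<subseteq> U" using ball_subset[of E U A "Suc a"] by (auto simp: layer_def)
          ultimately have "U - ?B b \<subset> U - ?B a"
            using step[OF False] by (auto simp: layer_def)
          then show "card (U - ?B b) < card (U - ?B a)"
            using less.prems(1) by (intro psubset_card_mono) auto
        qed (use b in auto)
        ultimately show ?thesis by (rule visits_trans)
      qed
    qed
    from this[of 0] show ?thesis by (simp only: K ball.simps simp_thms)
  qed
qed

end

section \<open>Back to sequences and the singleton rule\<close>

theorem theorem14:
  fixes V :: "'a set" and E :: "('a \<times> 'a) set" and n d_out :: nat
  assumes "finite_dag V E"
    and "card V = n"
    and "max_out_degree V E \<le> d_out"
  shows "\<exists>\<psi>. r_visit V (singleton_rule E) \<psi> \<and>
           real (max_boundary V (singleton_rule E) \<psi>)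
             \<le> 4 * (sqrt 2 + 1) * sqrt (real d_out * real n)"
proof -
  have V: "finite V" "E \<subseteq> V \<times> V" "acyclic E" using assms(1) by (auto simp: finite_dag_def)
  have E: "finite E" using V finite_subset by blast
  interpret bounded_degree_dag E d_out
  proof
    show "card (E `` {u}) \<le> d_out" for u
    proof (cases "u \<in> V")
      case True
      have "E `` {u} = successors E u" by (auto simp: successors_def)
      moreover have "card (successors E u) \<le> (MAX v\<in>V. card (successors E v))"
        using True V by (intro Max_ge) auto
      ultimately show ?thesis using assms(3) True by (auto simp: max_out_degree_def split: if_splits)
    next
      case False
      then have "E `` {u} = {}" using V by blast
      then show ?thesis by simp
    qed
  qed (use V E in auto)
  \<comment> \<open>The sources, which the empty enabler makes available at once.\<close>
  define A where "A = {v\<in>V. predecessors E v = {}}"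
  have "accessible E V A"
    unfolding accessible_def
  proof (intro allI impI)
    fix X assume "X \<subset> V"
    \<comment> \<open>A minimal vertex of \<open>V - X\<close> has all its predecessors in
      \<open>X\<close>: it is a source or a successor of \<open>X\<close>.\<close>
    moreover have "wf E" using E V(3) by (rule finite_acyclic_wf)
    ultimately obtain v where "v \<in> V - X" "\<And>y. (y, v) \<in> E \<Longrightarrow> y \<notin> V - X"
      using wfE_min[of E _ "V - X"] by blast
    then show "(V - X) \<inter> (A \<union> E `` X) \<noteq> {}"
      using V(2) by (fastforce simp: A_def predecessors_def)
  qed
  then obtain \<psi> where \<psi>: "distinct \<psi>" "set \<psi> = V"
    "\<forall>i<length \<psi>. \<psi> ! i \<in> A \<union> E `` set (take i \<psi>)"
    "\<forall>i\<le>length \<psi>. real (card (front E V A (set (take i \<psi>))))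
      \<le> 4 * (sqrt 2 + 1) * sqrt (real d_out * card V)"
    using visits_imp_list[OF visits_sqrt_bound[OF V(1), of A]] by (auto simp: A_def)
  have "r_visit V (singleton_rule E) \<psi>"
    unfolding r_visit_def r_sequence_def
  proof (intro conjI allI impI)
    fix i assume "i < length \<psi>"
    then have "\<psi> ! i \<in> A \<union> E `` set (take i \<psi>)" using \<psi>(3) by blast
    then show "\<exists>Q\<in>singleton_rule E (\<psi> ! i). Q \<subseteq> set (take i \<psi>)"
      by (auto simp: A_def singleton_rule_def predecessors_def)
  qed (use \<psi> in auto)
  moreover
  \<comment> \<open>The boundary asks for a non-empty enabler, which sources lack; this matches
    \<open>front\<close> ignoring \<open>A\<close>.\<close>
  have boundary: "boundary V (singleton_rule E) xs = front E V A (set xs)" for xs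
    by (auto simp: boundary_def front_def A_def singleton_rule_def predecessors_def split: if_splits)
  have "real (max_boundary V (singleton_rule E) \<psi>)
      \<le> 4 * (sqrt 2 + 1) * sqrt (real d_out * real n)"
  proof (cases "\<psi> = []")
    case False
    let ?M = "(\<lambda>i. card (boundary V (singleton_rule E) (take i \<psi>))) ` {1..length \<psi>}"
    have "Max ?M \<in> ?M" using False by (intro Max_in) (auto simp: Suc_le_eq)
    then obtain i where "i \<le> length \<psi>"
      "max_boundary V (singleton_rule E) \<psi> = card (boundary V (singleton_rule E) (take i \<psi>))"
      using False by (auto simp: max_boundary_def)
    then show ?thesis
      using \<psi>(4) assms(2) boundary by simp
  qed (simp add: max_boundary_def)
  ultimately show ?thesis by blast
qed

end
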